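(* A class $\mathcal{C}$ of finite split graphs is $\mathrm{MSO}_2$-orderable if, and only if, there is $s\in\mathbb{N}$ such that $\mathcal{C}$ has property $\mathsf{SEP}(f)$ for the function $f(n)=2^{s(n+1)}$.
   Context: A split graph is a graph whose vertex set can be partitioned into a set inducing a clique and an independent set. For $G=\langle V,E\rangle$, $\lceil G\rceil=\langle V\cup E,\mathrm{inc}\rangle$ (universe $V\cup E$, incidence relation). An MSO-formula $\varphi(x,y;Z_0,\dots,Z_{k-1})$ defines an order on a class $\mathcal{K}$ of structures if for every non-empty $\mathfrak{A}\in\mathcal{K}$ there are $P_0,\dots,P_{k-1}\subseteq A$ with $\{(a,b):\mathfrak{A}\models\varphi(a,b;\bar P)\}$ a linear order on $A$; a graph class is $\mathrm{MSO}_2$-orderable if some MSO-formula defines an order on $\{\lceil G\rceil\}$. $\mathrm{Sep}(G,k)$ is the maximum over vertex sets $S$, $|S|\le k$, of the number of connected components of $G-S$; $\mathcal{C}$ has $\mathsf{SEP}(f)$ if $\mathrm{Sep}(G,k)\le f(k)$ for all $G\in\mathcal{C}$ and all $k$. *)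

theory Defs
  imports Main
begin

type_synonym 'a graph = "'a set \<times> 'a set set"

definition verts :: "'a graph \<Rightarrow> 'a set" where "verts G = fst G"
definition edges :: "'a graph \<Rightarrow> 'a set set" where "edges G = snd G"

definition finite_graph :: "'a graph \<Rightarrow> bool" where
  "finite_graph G \<longleftrightarrow> finite (verts G) \<and>
     (\<forall>e\<in>edges G. \<exists>u v. u \<noteq> v \<and> u \<in> verts G \<and> v \<in> verts G \<and> e = {u, v})"

definition split_graph :: "'a graph \<Rightarrow> bool" where
  "split_graph G \<longleftrightarrow> (\<exists>C I. C \<inter> I = {} \<and> C \<union> I = verts G \<and>
     (\<forall>u\<in>C. \<forall>v\<in>C. u \<noteq> v \<longrightarrow> {u, v} \<in> edges G) \<and>
     (\<forall>u\<in>I. \<forall>v\<in>I. {u, v} \<notin> edges G))"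

definition adj_in :: "'a graph \<Rightarrow> 'a set \<Rightarrow> 'a \<Rightarrow> 'a \<Rightarrow> bool" where
  "adj_in G W u v \<longleftrightarrow> u \<in> W \<and> v \<in> W \<and> {u, v} \<in> edges G"

definition num_components :: "'a graph \<Rightarrow> 'a set \<Rightarrow> nat" where
  "num_components G S = card {C. \<exists>v \<in> verts G - S.
      C = {w. (adj_in G (verts G - S))\<^sup>*\<^sup>* v w}}"

definition Sep :: "'a graph \<Rightarrow> nat \<Rightarrow> nat" where
  "Sep G k = Max {num_components G S | S. S \<subseteq> verts G \<and> card S \<le> k}"

definition has_SEP :: "'a graph set \<Rightarrow> (nat \<Rightarrow> nat) \<Rightarrow> bool" where
  "has_SEP \<C> f \<longleftrightarrow> (\<forall>G\<in>\<C>. \<forall>k. Sep G k \<le> f k)"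

type_synonym 'u struct = "'u set \<times> ('u \<Rightarrow> 'u \<Rightarrow> bool)"

text \<open>First-order variables and set variables are indexed by natural numbers
  (two separate name spaces).\<close>
datatype mso =
    Eq nat nat
  | Rel nat nat
  | Mem nat nat
  | Neg mso
  | Conj mso mso
  | Ex1 nat mso
  | Ex2 nat mso

fun sat :: "'u struct \<Rightarrow> (nat \<Rightarrow> 'u) \<Rightarrow> (nat \<Rightarrow> 'u set) \<Rightarrow> mso \<Rightarrow> bool" where
  "sat \<AA> I J (Eq x y) = (I x = I y)"
| "sat \<AA> I J (Rel x y) = snd \<AA> (I x) (I y)"
| "sat \<AA> I J (Mem x X) = (I x \<in> J X)"
| "sat \<AA> I J (Neg \<phi>) = (\<not> sat \<AA> I J \<phi>)"
| "sat \<AA> I J (Conj \<phi> \<psi>) = (sat \<AA> I J \<phi> \<and> sat \<AA> I J \<psi>)"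
| "sat \<AA> I J (Ex1 x \<phi>) = (\<exists>a\<in>fst \<AA>. sat \<AA> (I(x := a)) J \<phi>)"
| "sat \<AA> I J (Ex2 X \<phi>) = (\<exists>P. P \<subseteq> fst \<AA> \<and> sat \<AA> I (J(X := P)) \<phi>)"

fun fv1 :: "mso \<Rightarrow> nat set" where
  "fv1 (Eq x y) = {x, y}"
| "fv1 (Rel x y) = {x, y}"
| "fv1 (Mem x X) = {x}"
| "fv1 (Neg \<phi>) = fv1 \<phi>"
| "fv1 (Conj \<phi> \<psi>) = fv1 \<phi> \<union> fv1 \<psi>"
| "fv1 (Ex1 x \<phi>) = fv1 \<phi> - {x}"
| "fv1 (Ex2 X \<phi>) = fv1 \<phi>"

fun fv2 :: "mso \<Rightarrow> nat set" where
  "fv2 (Eq x y) = {}"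
| "fv2 (Rel x y) = {}"
| "fv2 (Mem x X) = {X}"
| "fv2 (Neg \<phi>) = fv2 \<phi>"
| "fv2 (Conj \<phi> \<psi>) = fv2 \<phi> \<union> fv2 \<psi>"
| "fv2 (Ex1 x \<phi>) = fv2 \<phi>"
| "fv2 (Ex2 X \<phi>) = fv2 \<phi> - {X}"

text \<open>phi(x,y; Z_0,...,Z_{k-1}) with x = first-order variable 0, y = first-order
  variable 1, Z_i = set variable i, defines an order on the class K.\<close>
definition defines_order :: "mso \<Rightarrow> nat \<Rightarrow> 'u struct set \<Rightarrow> bool" where
  "defines_order \<phi> k K \<longleftrightarrow> fv1 \<phi> \<subseteq> {0, 1} \<and> fv2 \<phi> \<subseteq> {..<k} \<and>
     (\<forall>\<AA>\<in>K. fst \<AA> \<noteq> {} \<longrightarrow>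
        (\<exists>P. (\<forall>i<k. P i \<subseteq> fst \<AA>) \<and>
           linear_order_on (fst \<AA>)
             {(a, b). a \<in> fst \<AA> \<and> b \<in> fst \<AA> \<and>
                      sat \<AA> (\<lambda>i. if i = 0 then a else b) P \<phi>}))"

definition inc_struct :: "'a graph \<Rightarrow> ('a + 'a set) struct" where
  "inc_struct G = (Inl ` verts G \<union> Inr ` edges G,
     (\<lambda>x y. case (x, y) of (Inl v, Inr e) \<Rightarrow> v \<in> e | _ \<Rightarrow> False))"

definition MSO2_orderable :: "'a graph set \<Rightarrow> bool" where
  "MSO2_orderable \<C> \<longleftrightarrow> (\<exists>\<phi> k. defines_order \<phi> k (inc_struct ` \<C>))"

end

theory Submission
  imports Defs "HOL-Combinatorics.Transposition"
begin

text \<open>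
  If a formula with \<open>k\<close> set parameters orders a split graph, no two independent vertices can have
  the same neighbourhood and receive the same colours on themselves and their incident edges, since
  swapping them would be an automorphism. So at most \<open>2\<^sup>n \<cdot> 2\<^bsup>k(n+1)\<^esup>\<close> independent vertices become
  isolated when \<open>n\<close> vertices are deleted, and there is at most one further component.

  Conversely, bounded separation allows at most \<open>2\<^bsup>s(|S|+1)\<^esup>\<close> independent vertices with
  neighbourhood \<open>S\<close>, so \<open>s\<close> colour sets on vertices and edges tell them apart. With one set of
  clique edges and vertices encoding a threshold graph, the clique is ordered by inclusion of
  neighbourhoods. Independent vertices are then compared lexicographically by neighbourhoods and
  colours, and edges by their endpoints. All of this is first-order in the parameters.
\<close>

section \<open>Split graphs and their separation number\<close>

definition split_partition :: "'a graph \<Rightarrow> 'a set \<Rightarrow> 'a set \<Rightarrow> bool" where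
  "split_partition G C I \<longleftrightarrow> C \<inter> I = {} \<and> C \<union> I = verts G \<and>
     (\<forall>u\<in>C. \<forall>v\<in>C. u \<noteq> v \<longrightarrow> {u, v} \<in> edges G) \<and>
     (\<forall>u\<in>I. \<forall>v\<in>I. {u, v} \<notin> edges G)"

lemma split_graph_iff: "split_graph G \<longleftrightarrow> (\<exists>C I. split_partition G C I)"
  by (simp add: split_graph_def split_partition_def)

definition nbrs :: "'a graph \<Rightarrow> 'a \<Rightarrow> 'a set" where
  "nbrs G v = {c. {v, c} \<in> edges G}"

definition component :: "'a graph \<Rightarrow> 'a set \<Rightarrow> 'a \<Rightarrow> 'a set" where
  "component G S v = {w. (adj_in G (verts G - S))\<^sup>*\<^sup>* v w}"

lemma num_components_eq: "num_components G S = card (component G S ` (verts G - S))"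
  unfolding num_components_def component_def image_def by simp

lemma edge_endpoints:
  assumes "finite_graph G" "{u, v} \<in> edges G"
  shows "u \<noteq> v" "u \<in> verts G" "v \<in> verts G"
  using assms unfolding finite_graph_def by (metis doubleton_eq_iff)+

lemma nbrs_subset_clique:
  assumes "finite_graph G" "split_partition G C I" "v \<in> I"
  shows "nbrs G v \<subseteq> C"
  using assms edge_endpoints[OF assms(1)] unfolding nbrs_def split_partition_def by blast

lemma component_isolated:
  assumes "nbrs G v \<subseteq> S"
  shows "component G S v = {v}"
proof -
  have "\<not> adj_in G (verts G - S) v w" for w
    using assms by (auto simp: adj_in_def nbrs_def)
  then have "(adj_in G (verts G - S))\<^sup>*\<^sup>* v w \<Longrightarrow> w = v" for w
    by (metis converse_rtranclpE)
  then show ?thesis by (auto simp: component_def)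
qed

lemma component_eq_if_reachable:
  assumes "(adj_in G (verts G - S))\<^sup>*\<^sup>* v w"
  shows "component G S v = component G S w"
proof -
  have "symp (adj_in G (verts G - S))"
    by (auto simp: symp_def adj_in_def insert_commute)
  then have "(adj_in G (verts G - S))\<^sup>*\<^sup>* w v"
    using assms by (metis sympD symp_rtranclp)
  with assms show ?thesis
    unfolding component_def by (auto intro: rtranclp_trans)
qed

lemma finite_num_components:
  assumes "finite_graph G"
  shows "finite {num_components G S | S. S \<subseteq> verts G \<and> card S \<le> k}"
proof (rule finite_subset)
  show "{num_components G S | S. S \<subseteq> verts G \<and> card S \<le> k} \<subseteq> num_components G ` Pow (verts G)"
    by auto
  show "finite (num_components G ` Pow (verts G))"
    using assms by (simp add: finite_graph_def)
qed

text \<open>A \<open>Max\<close> bounds its members only over a finite non-empty set: finiteness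
  comes from the finitely many vertex sets, non-emptiness from deleting nothing.\<close>

lemma Sep_le_iff:
  assumes "finite_graph G"
  shows "Sep G k \<le> m \<longleftrightarrow> (\<forall>S. S \<subseteq> verts G \<longrightarrow> card S \<le> k \<longrightarrow> num_components G S \<le> m)"
proof -
  have "{num_components G S | S. S \<subseteq> verts G \<and> card S \<le> k} \<noteq> {}"
    by (auto intro!: exI[of _ "{}"])
  then show ?thesis
    unfolding Sep_def using finite_num_components[OF assms] by (subst Max_le_iff) auto
qed

text \<open>All components of \<open>G - S\<close> other than these isolated vertices contain a vertex of the
  clique, so there is at most one of them.\<close>
lemma num_components_le:
  assumes fin: "finite_graph G" and split: "split_partition G C I"
  shows "num_components G S \<le> card {v\<in>I. nbrs G v \<subseteq> S} + 1"
proof -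
  let ?W = "verts G - S" and ?T = "{v\<in>I. nbrs G v \<subseteq> S}"
  let ?R = "adj_in G ?W"
  have CI: "C \<union> I = verts G" and clique: "\<And>u v. u \<in> C \<Longrightarrow> v \<in> C \<Longrightarrow> u \<noteq> v \<Longrightarrow> {u, v} \<in> edges G"
    using split by (auto simp: split_partition_def)
  \<comment> \<open>A surviving vertex lies in the clique itself or, not being isolated, has a
    neighbour outside \<open>S\<close>, which must lie in the clique.\<close>
  have ex: "\<exists>c\<in>C - S. ?R\<^sup>*\<^sup>* v c" if "v \<in> ?W" "v \<notin> ?T" for v
  proof (cases "v \<in> C")
    case True
    with that show ?thesis by blast
  next
    case False
    with that CI have "v \<in> I" by blast
    with that obtain c where "c \<in> nbrs G v" "c \<notin> S" by blast
    moreover have "c \<in> C" using nbrs_subset_clique[OF fin split \<open>v \<in> I\<close>] calculation by blast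
    moreover have "?R v c"
      using calculation that CI by (auto simp: adj_in_def nbrs_def)
    ultimately show ?thesis by blast
  qed
  have same: "component G S v = component G S w" if "v \<in> ?W - ?T" "w \<in> ?W - ?T" for v w
  proof -
    obtain c d where cd: "c \<in> C - S" "?R\<^sup>*\<^sup>* v c" "d \<in> C - S" "?R\<^sup>*\<^sup>* w d"
      using ex \<open>v \<in> _\<close> \<open>w \<in> _\<close> by (metis DiffE)
    have "?R\<^sup>*\<^sup>* c d"
    proof (cases "c = d")
      case False
      then have "?R c d" using cd CI clique by (auto simp: adj_in_def)
      then show ?thesis by blast
    qed simp
    then show ?thesis using cd component_eq_if_reachable by metis
  qed
  have finV: "finite (verts G)" using fin by (simp add: finite_graph_def)
  have finT: "finite ?T" using finV CI by (metis (no_types, lifting) finite_Un finite_subset mem_Collect_eq subsetI)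
  have one: "card (component G S ` (?W - ?T)) \<le> 1"
  proof -
    have "\<forall>X\<in>component G S ` (?W - ?T). \<forall>Y\<in>component G S ` (?W - ?T). X = Y"
    proof (intro ballI, elim imageE)
      fix X Y v w
      assume "X = component G S v" "v \<in> ?W - ?T" "Y = component G S w" "w \<in> ?W - ?T"
      then show "X = Y" using same[of v w] by metis
    qed
    then show ?thesis
      unfolding One_nat_def
      by (intro iffD2[OF card_le_Suc0_iff_eq]) (simp_all only: finV finite_Diff finite_imageI)
  qed
  have "component G S ` ?W \<subseteq> component G S ` ?T \<union> component G S ` (?W - ?T)" by blast
  then have "card (component G S ` ?W) \<le> card (component G S ` ?T \<union> component G S ` (?W - ?T))"
    using finV finT by (intro card_mono) auto
  also have "\<dots> \<le> card (component G S ` ?T) + card (component G S ` (?W - ?T))"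
    by (rule card_Un_le)
  also have "\<dots> \<le> card ?T + 1"
    using one card_image_le[OF finT, of "component G S"] by (meson add_mono)
  finally show ?thesis by (simp add: num_components_eq)
qed

text \<open>Deleting \<open>S\<close> isolates every independent vertex with neighbourhood
  \<open>S\<close>, so these vertices yield pairwise distinct singleton components. As
  \<open>S\<close> lies in the clique, none of them is deleted.\<close>

lemma card_twins_le_num_components:
  assumes fin: "finite_graph G" and split: "split_partition G C I" and "S \<subseteq> C"
  shows "card {v\<in>I. nbrs G v = S} \<le> num_components G S"
proof -
  let ?T = "{v\<in>I. nbrs G v = S}"
  have "?T \<subseteq> verts G - S" and "finite (verts G)"
    using assms by (auto simp: split_partition_def finite_graph_def)
  moreover have "inj_on (component G S) ?T"
    by (rule inj_onI) (auto simp: component_isolated)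
  ultimately have "card ?T \<le> card (component G S ` (verts G - S))"
    using card_mono[of "component G S ` (verts G - S)" "component G S ` ?T"]
    by (simp add: card_image image_mono)
  then show ?thesis by (simp add: num_components_eq)
qed

section \<open>Colours of an independent vertex\<close>

text \<open>The colours that sets \<open>P\<^sub>0, \<dots>, P\<^sub>k\<^sub>-\<^sub>1\<close> of vertices and edges assign to a vertex \<open>v\<close>
  (index \<open>None\<close>) and to the edge from \<open>v\<close> to its neighbour \<open>c\<close> (index \<open>Some c\<close>).\<close>
definition code :: "'a graph \<Rightarrow> nat \<Rightarrow> (nat \<Rightarrow> ('a + 'a set) set) \<Rightarrow> 'a \<Rightarrow> (nat \<times> 'a option) set" where
  "code G k P v = {(i, None) | i. i < k \<and> Inl v \<in> P i} \<union>
     {(i, Some c) | i c. i < k \<and> c \<in> nbrs G v \<and> Inr {v, c} \<in> P i}"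

text \<open>The possible values of \<open>code\<close> for neighbourhoods inside \<open>S\<close>:
  one bit for each of \<open>k\<close> colours and each of the vertex itself and the
  \<open>card S\<close> potential edges. This is the source of the exponent
  \<open>k * (card S + 1)\<close>.\<close>

definition codes :: "nat \<Rightarrow> 'a set \<Rightarrow> (nat \<times> 'a option) set set" where
  "codes k S = Pow ({..<k} \<times> insert None (Some ` S))"

lemma code_in_codes: "nbrs G v \<subseteq> S \<Longrightarrow> code G k P v \<in> codes k S"
  by (auto simp: code_def codes_def)

lemma finite_codes: "finite S \<Longrightarrow> finite (codes k S)"
  by (simp add: codes_def)

lemma card_codes: "finite S \<Longrightarrow> card (codes k S) = 2 ^ (k * (card S + 1))"
  by (simp add: codes_def card_Pow card_cartesian_product card_image)

section \<open>Orderable classes have bounded separation\<close>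

text \<open>Induction on the formula; the quantifier cases use that \<open>h\<close> permutes the
  elements and the subsets of the universe. Taking \<open>h\<close> bijective on the whole type
  allows assignments with values outside the universe.\<close>

lemma sat_automorphism:
  assumes "bij h" "h ` fst \<AA> = fst \<AA>" "\<And>a b. snd \<AA> (h a) (h b) = snd \<AA> a b"
    and "\<And>X. X \<in> fv2 \<phi> \<Longrightarrow> J' X = h ` J X"
  shows "sat \<AA> (h \<circ> I) J' \<phi> = sat \<AA> I J \<phi>"
  using assms(4)
proof (induction \<phi> arbitrary: I J J')
  case (Eq x y)
  then show ?case using assms(1) by (simp add: bij_is_inj inj_eq)
next
  case (Rel x y)
  then show ?case using assms(3) by simp
next
  case (Mem x X)
  then show ?case using assms(1) by (simp add: bij_is_inj inj_image_mem_iff)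
next
  case (Ex1 x \<phi>)
  have IH: "sat \<AA> (h \<circ> I') J' \<phi> = sat \<AA> I' J \<phi>" for I'
    using Ex1.prems by (intro Ex1.IH) simp
  have *: "(h \<circ> I)(x := h a) = h \<circ> I(x := a)" for a by auto
  have "sat \<AA> (h \<circ> I) J' (Ex1 x \<phi>) \<longleftrightarrow> (\<exists>a\<in>h ` fst \<AA>. sat \<AA> ((h \<circ> I)(x := a)) J' \<phi>)"
    using assms(2) by simp
  also have "\<dots> \<longleftrightarrow> (\<exists>a\<in>fst \<AA>. sat \<AA> (h \<circ> I(x := a)) J' \<phi>)" by (simp add: *)
  also have "\<dots> \<longleftrightarrow> sat \<AA> I J (Ex1 x \<phi>)" by (simp only: sat.simps IH)
  finally show ?case .
next
  case (Ex2 X \<phi>)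
  have IH: "sat \<AA> (h \<circ> I) (J'(X := h ` P)) \<phi> = sat \<AA> I (J(X := P)) \<phi>" for P
    using Ex2.prems by (intro Ex2.IH) auto
  have sub: "Q \<subseteq> fst \<AA> \<longleftrightarrow> (\<exists>P. P \<subseteq> fst \<AA> \<and> Q = h ` P)" for Q
    using subset_image_iff[of Q h "fst \<AA>"] assms(2) by simp
  have "sat \<AA> (h \<circ> I) J' (Ex2 X \<phi>) \<longleftrightarrow>
      (\<exists>Q. (\<exists>P. P \<subseteq> fst \<AA> \<and> Q = h ` P) \<and> sat \<AA> (h \<circ> I) (J'(X := Q)) \<phi>)"
    unfolding sat.simps by (intro iff_exI conj_cong sub refl)
  also have "\<dots> \<longleftrightarrow> (\<exists>P. P \<subseteq> fst \<AA> \<and> sat \<AA> (h \<circ> I) (J'(X := h ` P)) \<phi>)" by blast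
  also have "\<dots> \<longleftrightarrow> sat \<AA> I J (Ex2 X \<phi>)" by (simp only: sat.simps IH)
  finally show ?case .
qed simp_all

section \<open>Swapping two independent vertices in the incidence structure\<close>

definition lift :: "('a \<Rightarrow> 'a) \<Rightarrow> 'a + 'a set \<Rightarrow> 'a + 'a set" where
  "lift t = map_sum t ((`) t)"

lemma lift_simps [simp]: "lift t (Inl v) = Inl (t v)" "lift t (Inr e) = Inr (t ` e)"
  by (simp_all add: lift_def)

lemma lift_transpose_involutory: "lift (transpose v w) (lift (transpose v w) x) = x"
  by (cases x) (simp_all add: image_image)

lemma image_eq_of_involutory:
  assumes "\<And>x. h (h x) = x" "\<And>x. x \<in> A \<Longrightarrow> h x \<in> A"
  shows "h ` A = A"
  using assms by (metis image_subsetI rev_image_eqI subsetI subset_antisym)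

lemma transpose_image_fix: "v \<notin> e \<Longrightarrow> w \<notin> e \<Longrightarrow> transpose v w ` e = e"
  by (auto simp: transpose_def image_iff)

text \<open>No edge contains both \<open>v\<close> and \<open>w\<close>, since both are independent.
  An edge at one of them has its other end \<open>c\<close> in the clique, and the swap fixes
  \<open>c\<close>.\<close>

lemma edge_swap_cases:
  assumes fin: "finite_graph G" and split: "split_partition G C I"
    and v: "v \<in> I" and w: "w \<in> I" and e: "e \<in> edges G"
  obtains c where "c \<in> C" "c \<in> nbrs G v" "e = {v, c}" "transpose v w ` e = {w, c}"
  | c where "c \<in> C" "c \<in> nbrs G w" "e = {w, c}" "transpose v w ` e = {v, c}"
  | "transpose v w ` e = e"
proof -
  obtain a b where ab: "e = {a, b}" using fin e by (auto simp: finite_graph_def)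
  have disj: "C \<inter> I = {}" using split by (auto simp: split_partition_def)
  show thesis
  proof (cases "v \<in> e")
    case True
    then obtain c where c: "e = {v, c}" using ab by auto
    then have "c \<in> nbrs G v" using e by (simp add: nbrs_def)
    moreover from this have "c \<in> C" using nbrs_subset_clique[OF fin split v] by blast
    moreover from this have "transpose v w ` e = {w, c}"
      using c disj v w by (auto simp: transpose_def)
    ultimately show ?thesis using that(1) c by blast
  next
    case nv: False
    show ?thesis
    proof (cases "w \<in> e")
      case True
      then obtain c where c: "e = {w, c}" using ab by auto
      then have "c \<in> nbrs G w" using e by (simp add: nbrs_def)
      moreover from this have "c \<in> C" using nbrs_subset_clique[OF fin split w] by blast
      moreover from this have "transpose v w ` e = {v, c}"
        using c disj v w by (auto simp: transpose_def)
      ultimately show ?thesis using that(2) c by blast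
    next
      case False
      then show ?thesis using nv by (intro that(3) transpose_image_fix)
    qed
  qed
qed

text \<open>Swapping two twins with the same colours is an automorphism, so an order cannot tell
  them apart.\<close>
lemma twins_eq:
  assumes fin: "finite_graph G" and split: "split_partition G C I"
    and fv: "fv2 \<phi> \<subseteq> {..<k}" and P: "\<forall>i<k. P i \<subseteq> fst (inc_struct G)"
    and lin: "linear_order_on (fst (inc_struct G))
       {(a, b). a \<in> fst (inc_struct G) \<and> b \<in> fst (inc_struct G) \<and>
                sat (inc_struct G) (\<lambda>i. if i = 0 then a else b) P \<phi>}" (is "linear_order_on ?A ?L")
    and v: "v \<in> I" and w: "w \<in> I" and nb: "nbrs G v = nbrs G w"
    and col: "code G k P v = code G k P w"
  shows "v = w"
proof -
  define t where "t = transpose v w"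
  define h where "h = lift t"
  have hh: "h (h x) = x" for x by (simp add: h_def t_def lift_transpose_involutory)
  have bij: "bij h" using hh by (rule involuntory_imp_bij)
  have vV: "v \<in> verts G" "w \<in> verts G" using v w split by (auto simp: split_partition_def)
  have A: "?A = Inl ` verts G \<union> Inr ` edges G" by (simp add: inc_struct_def)
  have tv: "t x \<in> verts G" if "x \<in> verts G" for x
    using that vV by (auto simp: t_def transpose_def)
  have te: "t ` e \<in> edges G" if "e \<in> edges G" for e
    using edge_swap_cases[OF fin split v w that] that nb unfolding t_def nbrs_def
    by (metis mem_Collect_eq)
  have hA: "h ` ?A = ?A"
    using hh by (rule image_eq_of_involutory) (auto simp: A h_def tv te)
  have injt: "inj t" by (simp add: t_def)
  have rel: "snd (inc_struct G) (h a) (h b) = snd (inc_struct G) a b" for a b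
    by (cases a; cases b) (auto simp: inc_struct_def h_def inj_image_mem_iff[OF injt])
  have bit: "Inl v \<in> P i \<longleftrightarrow> Inl w \<in> P i" if "i < k" for i
  proof -
    have "(i, None) \<in> code G k P v \<longleftrightarrow> (i, None) \<in> code G k P w" using col by simp
    then show ?thesis using that by (simp add: code_def)
  qed
  have ebit: "Inr {v, c} \<in> P i \<longleftrightarrow> Inr {w, c} \<in> P i" if "i < k" "c \<in> nbrs G v" for i c
  proof -
    have "(i, Some c) \<in> code G k P v \<longleftrightarrow> (i, Some c) \<in> code G k P w" using col by simp
    then show ?thesis using that nb by (simp add: code_def)
  qed
  \<comment> \<open>Only \<open>v\<close>, \<open>w\<close> and their incident edges move, and equal
    codes give each of these the same colours as its image.\<close>
  have hP: "h x \<in> P i" if "i < k" "x \<in> P i" for i x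
  proof (cases x)
    case (Inl y)
    consider "y = v" | "y = w" | "y \<noteq> v" "y \<noteq> w" by blast
    then show ?thesis
    proof cases
      case 1
      then have "h x = Inl w" using Inl by (simp add: h_def t_def)
      then show ?thesis using bit[OF that(1)] that(2) 1 Inl by metis
    next
      case 2
      then have "h x = Inl v" using Inl by (simp add: h_def t_def)
      then show ?thesis using bit[OF that(1)] that(2) 2 Inl by metis
    next
      case 3
      then have "h x = x" using Inl by (simp add: h_def t_def)
      then show ?thesis using that(2) by simp
    qed
  next
    case (Inr e)
    with that P A have e: "e \<in> edges G" by blast
    show ?thesis
    proof (cases rule: edge_swap_cases[OF fin split v w e])
      case (1 c)
      then show ?thesis using that Inr ebit[of i c] by (simp add: h_def t_def)
    next
      case (2 c)
      then show ?thesis using that Inr ebit[of i c] nb by (simp add: h_def t_def)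
    next
      case 3
      then show ?thesis using that Inr by (simp add: h_def t_def)
    qed
  qed
  have "h ` P i = P i" if "i < k" for i
    using hh hP[OF that] by (rule image_eq_of_involutory)
  then have inv: "\<And>X. X \<in> fv2 \<phi> \<Longrightarrow> P X = h ` P X" using fv by auto
  have swap: "h \<circ> (\<lambda>i. if i = (0::nat) then Inl v else Inl w) = (\<lambda>i. if i = 0 then Inl w else Inl v)"
    by (auto simp: h_def t_def)
  \<comment> \<open>The swap exchanges the two arguments and preserves the parameters, so the order
    holds in both directions or in neither; totality and antisymmetry then exclude
    \<open>v \<noteq> w\<close>.\<close>
  have iff: "(Inl v, Inl w) \<in> ?L \<longleftrightarrow> (Inl w, Inl v) \<in> ?L"
    using sat_automorphism[OF bij hA rel inv, where I = "\<lambda>i. if i = 0 then Inl v else Inl w"] swap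
    by auto
  have "total_on ?A ?L" "antisym ?L"
    using lin by (auto simp: linear_order_on_def partial_order_on_def)
  moreover have "Inl v \<in> ?A" "Inl w \<in> ?A" using vV A by auto
  ultimately show "v = w" using iff by (metis (no_types, lifting) Inl_inject antisymD total_on_def)
qed

lemma orderable_imp_SEP:
  assumes gr: "\<forall>G\<in>\<C>. finite_graph G \<and> split_graph G"
    and ord: "defines_order \<phi> k (inc_struct ` \<C>)"
  shows "has_SEP \<C> (\<lambda>n. 2 ^ ((k + 1) * (n + 1)))"
proof -
  have fv: "fv2 \<phi> \<subseteq> {..<k}" using ord by (simp add: defines_order_def)
  have "num_components G S \<le> 2 ^ ((k + 1) * (n + 1))"
    if G: "G \<in> \<C>" and S: "S \<subseteq> verts G" "card S \<le> n" for G S n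
  proof -
    have fin: "finite_graph G" using gr G by blast
    obtain C I where split: "split_partition G C I" using gr G split_graph_iff by blast
    let ?T = "{v\<in>I. nbrs G v \<subseteq> S}"
    have finS: "finite S" using S fin finite_subset by (auto simp: finite_graph_def)
    have T: "card ?T \<le> 2 ^ n * 2 ^ (k * (n + 1))"
    proof (cases "fst (inc_struct G) = {}")
      case True
      then have "I = {}" using split by (auto simp: inc_struct_def split_partition_def)
      then show ?thesis by simp
    next
      case False
      then obtain P where P: "\<forall>i<k. P i \<subseteq> fst (inc_struct G)"
        and lin: "linear_order_on (fst (inc_struct G))
          {(a, b). a \<in> fst (inc_struct G) \<and> b \<in> fst (inc_struct G) \<and>
             sat (inc_struct G) (\<lambda>i. if i = 0 then a else b) P \<phi>}"
        using ord G unfolding defines_order_def by blast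
      let ?f = "\<lambda>v. (nbrs G v, code G k P v)"
      have "inj_on ?f ?T"
        using twins_eq[OF fin split fv P lin] by (auto intro!: inj_onI)
      moreover have "?f ` ?T \<subseteq> Pow S \<times> codes k S"
      proof (rule image_subsetI)
        fix v assume "v \<in> ?T"
        then show "?f v \<in> Pow S \<times> codes k S" using code_in_codes[of G v S k P] by simp
      qed
      ultimately have "card ?T \<le> card (Pow S \<times> codes k S)"
        using finS by (intro card_inj_on_le) (auto intro: finite_codes)
      also have "\<dots> = 2 ^ card S * 2 ^ (k * (card S + 1))"
        using finS by (simp add: card_cartesian_product card_Pow card_codes)
      also have "\<dots> \<le> 2 ^ n * 2 ^ (k * (n + 1))"
        using S by (intro mult_mono power_increasing) auto
      finally show ?thesis .
    qed
    have "num_components G S \<le> card ?T + 1" by (rule num_components_le[OF fin split])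
    \<comment> \<open>The one extra component is absorbed by doubling the bound, which turns the
      factor \<open>2 ^ n\<close> into \<open>2 ^ (n + 1)\<close> and so gives the constant
      \<open>k + 1\<close>.\<close>
    also have "\<dots> \<le> 2 ^ n * 2 ^ (k * (n + 1)) + 2 ^ n * 2 ^ (k * (n + 1))"
      by (rule add_mono[OF T]) simp
    also have "\<dots> = 2 ^ ((k + 1) * (n + 1))"
      by (simp add: power_add algebra_simps)
    finally show ?thesis .
  qed
  then show ?thesis using gr by (auto simp: has_SEP_def Sep_le_iff)
qed

section \<open>Strict weak orders\<close>

text \<open>Asymmetry and cotransitivity imply transitivity and make incomparability an equivalence.
  Unlike strict linear orders, such relations are closed under pullback, which allows an order to be
  built from layers that each separate only some elements.\<close>

definition weak_order :: "('b \<Rightarrow> 'b \<Rightarrow> bool) \<Rightarrow> bool" where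
  "weak_order R \<longleftrightarrow> (\<forall>a b. R a b \<longrightarrow> \<not> R b a) \<and> (\<forall>a b c. R a c \<longrightarrow> R a b \<or> R b c)"

lemma weak_order_asym: "weak_order R \<Longrightarrow> R a b \<Longrightarrow> \<not> R b a"
  by (auto simp: weak_order_def)

lemma weak_order_trans: "weak_order R \<Longrightarrow> R a b \<Longrightarrow> R b c \<Longrightarrow> R a c"
  unfolding weak_order_def by blast

lemma weak_order_pullback: "weak_order R \<Longrightarrow> weak_order (\<lambda>a b. R (f a) (f b))"
  unfolding weak_order_def by blast

definition lexc :: "('b \<Rightarrow> 'b \<Rightarrow> bool) \<Rightarrow> ('b \<Rightarrow> 'b \<Rightarrow> bool) \<Rightarrow> 'b \<Rightarrow> 'b \<Rightarrow> bool" where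
  "lexc R S a b \<longleftrightarrow> R a b \<or> \<not> R b a \<and> S a b"

lemma weak_order_lexc: "weak_order R \<Longrightarrow> weak_order S \<Longrightarrow> weak_order (lexc R S)"
  unfolding weak_order_def lexc_def by (intro conjI; metis)

lemma lexc_total: "S a b \<or> S b a \<Longrightarrow> lexc R S a b \<or> lexc R S b a"
  "R a b \<or> R b a \<Longrightarrow> lexc R S a b \<or> lexc R S b a"
  by (auto simp: lexc_def)

text \<open>Subsets of \<open>C\<close> are compared at the greatest element of their symmetric difference.\<close>
definition set_less :: "'b set \<Rightarrow> ('b \<Rightarrow> 'b \<Rightarrow> bool) \<Rightarrow> ('b \<Rightarrow> bool) \<Rightarrow> ('b \<Rightarrow> bool) \<Rightarrow> bool" where
  "set_less C B p q \<longleftrightarrow> (\<exists>z\<in>C. q z \<and> \<not> p z \<and> (\<forall>u\<in>C. B z u \<longrightarrow> (p u \<longleftrightarrow> q u)))"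

text \<open>Points outside \<open>C\<close> satisfy neither predicate, so they are no witnesses and
  cause no disagreement. A formula may therefore quantify over the whole universe.\<close>

lemma set_less_restrict:
  assumes "\<And>u. p u \<Longrightarrow> u \<in> C" "\<And>u. q u \<Longrightarrow> u \<in> C" "C \<subseteq> D"
  shows "set_less D B p q \<longleftrightarrow> set_less C B p q"
proof -
  have "(\<forall>u\<in>D. B z u \<longrightarrow> p u = q u) \<longleftrightarrow> (\<forall>u\<in>C. B z u \<longrightarrow> p u = q u)" for z
    using assms by blast
  then show ?thesis
    unfolding set_less_def using assms(2,3) by (simp only:) blast
qed

text \<open>The axioms are relative to \<open>C\<close> because the relations defined by formulas
  live on the whole universe and are linear only on the clique or on the vertices.\<close>

locale finite_strict_order =
  fixes C :: "'b set" and B :: "'b \<Rightarrow> 'b \<Rightarrow> bool"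
  assumes fin: "finite C"
    and asym: "a \<in> C \<Longrightarrow> b \<in> C \<Longrightarrow> B a b \<Longrightarrow> \<not> B b a"
    and trans: "a \<in> C \<Longrightarrow> b \<in> C \<Longrightarrow> c \<in> C \<Longrightarrow> B a b \<Longrightarrow> B b c \<Longrightarrow> B a c"
    and total: "a \<in> C \<Longrightarrow> b \<in> C \<Longrightarrow> a \<noteq> b \<Longrightarrow> B a b \<or> B b a"
begin

lemma set_less_total:
  assumes "u \<in> C" "p u \<noteq> q u"
  shows "set_less C B p q \<or> set_less C B q p"
proof -
  let ?D = "{u\<in>C. p u \<noteq> q u}"
  \<comment> \<open>By finiteness, the set of disagreements has a maximal element; above it the
    predicates agree, so it decides the comparison.\<close>
  have "\<exists>m\<in>?D. \<forall>x\<in>?D. x \<noteq> m \<longrightarrow> \<not> B m x"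
  proof (rule Finite_Set.bex_max_element)
    show "asymp_on ?D B" using asym by (simp add: asymp_on_def)
    show "transp_on ?D B"
      unfolding transp_on_def using trans by (metis (no_types, lifting) mem_Collect_eq)
  qed (use assms fin in auto)
  then obtain m where m: "m \<in> C" "p m \<noteq> q m"
    and max: "\<And>x. x \<in> C \<Longrightarrow> p x \<noteq> q x \<Longrightarrow> x \<noteq> m \<Longrightarrow> \<not> B m x" by blast
  have "\<not> B m m" using asym[of m m] m(1) by blast
  then have "p x = q x" if "x \<in> C" "B m x" for x using that max by metis
  with m show ?thesis unfolding set_less_def by metis
qed

lemma set_less_asym: "set_less C B p q \<Longrightarrow> \<not> set_less C B q p"
  unfolding set_less_def using total by metis

lemma set_less_trans: "set_less C B p q \<Longrightarrow> set_less C B q r \<Longrightarrow> set_less C B p r"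
  unfolding set_less_def
proof (elim bexE conjE)
  fix x y
  assume x: "x \<in> C" "q x" "\<not> p x" "\<forall>u\<in>C. B x u \<longrightarrow> p u = q u"
    and y: "y \<in> C" "r y" "\<not> q y" "\<forall>u\<in>C. B y u \<longrightarrow> q u = r u"
  \<comment> \<open>The witnesses differ because \<open>q\<close> holds at only one of them; the
    greater one witnesses the composed comparison.\<close>
  then consider "B x y" | "B y x" using total by metis
  then show "\<exists>z\<in>C. r z \<and> \<not> p z \<and> (\<forall>u\<in>C. B z u \<longrightarrow> p u = r u)"
  proof cases
    case 1
    then show ?thesis using x y trans by (intro bexI[of _ y]) blast+
  next
    case 2
    then show ?thesis using x y trans by (intro bexI[of _ x]) blast+
  qed
qed

text \<open>Only a weak order results: predicates that agree on \<open>C\<close> are incomparable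
  even if they differ elsewhere.\<close>

lemma weak_order_set_less: "weak_order (set_less C B)"
  unfolding weak_order_def
proof (intro conjI allI impI)
  fix p q r :: "'b \<Rightarrow> bool"
  assume pr: "set_less C B p r"
  show "set_less C B p q \<or> set_less C B q r"
  proof (cases "\<forall>u\<in>C. p u = q u")
    case True
    then have "set_less C B q r" using pr unfolding set_less_def by metis
    then show ?thesis ..
  next
    case False
    then show ?thesis using set_less_total pr set_less_trans by metis
  qed
qed (use set_less_asym in blast)

end

section \<open>The ordering formula\<close>

definition Disj :: "mso \<Rightarrow> mso \<Rightarrow> mso" where "Disj \<phi> \<psi> = Neg (Conj (Neg \<phi>) (Neg \<psi>))"
definition Imp :: "mso \<Rightarrow> mso \<Rightarrow> mso" where "Imp \<phi> \<psi> = Neg (Conj \<phi> (Neg \<psi>))"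
definition Iff :: "mso \<Rightarrow> mso \<Rightarrow> mso" where "Iff \<phi> \<psi> = Conj (Imp \<phi> \<psi>) (Imp \<psi> \<phi>)"
definition All1 :: "nat \<Rightarrow> mso \<Rightarrow> mso" where "All1 x \<phi> = Neg (Ex1 x (Neg \<phi>))"

lemma sat_derived [simp]:
  "sat \<AA> I J (Disj \<phi> \<psi>) \<longleftrightarrow> sat \<AA> I J \<phi> \<or> sat \<AA> I J \<psi>"
  "sat \<AA> I J (Imp \<phi> \<psi>) \<longleftrightarrow> (sat \<AA> I J \<phi> \<longrightarrow> sat \<AA> I J \<psi>)"
  "sat \<AA> I J (Iff \<phi> \<psi>) \<longleftrightarrow> (sat \<AA> I J \<phi> \<longleftrightarrow> sat \<AA> I J \<psi>)"
  "sat \<AA> I J (All1 x \<phi>) \<longleftrightarrow> (\<forall>a\<in>fst \<AA>. sat \<AA> (I(x := a)) J \<phi>)"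
  by (auto simp: Disj_def Imp_def Iff_def All1_def)

lemma fv_derived [simp]:
  "fv1 (Disj \<phi> \<psi>) = fv1 \<phi> \<union> fv1 \<psi>" "fv2 (Disj \<phi> \<psi>) = fv2 \<phi> \<union> fv2 \<psi>"
  "fv1 (Imp \<phi> \<psi>) = fv1 \<phi> \<union> fv1 \<psi>" "fv2 (Imp \<phi> \<psi>) = fv2 \<phi> \<union> fv2 \<psi>"
  "fv1 (Iff \<phi> \<psi>) = fv1 \<phi> \<union> fv1 \<psi>" "fv2 (Iff \<phi> \<psi>) = fv2 \<phi> \<union> fv2 \<psi>"
  "fv1 (All1 x \<phi>) = fv1 \<phi> - {x}" "fv2 (All1 x \<phi>) = fv2 \<phi>"
  by (auto simp: Disj_def Imp_def Iff_def All1_def)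

text \<open>A set \<open>Z\<close> of vertices and edges is read as a symmetric relation on vertices, whose loops
  are the vertices in \<open>Z\<close>.\<close>
definition joined :: "'u struct \<Rightarrow> 'u set \<Rightarrow> 'u \<Rightarrow> 'u \<Rightarrow> bool" where
  "joined \<AA> Z a b \<longleftrightarrow> a = b \<and> a \<in> Z \<or> a \<noteq> b \<and> (\<exists>e\<in>fst \<AA>. e \<in> Z \<and> snd \<AA> a e \<and> snd \<AA> b e)"

text \<open>Every layer of formulas binds variables of its own: 2 here, then 3, then 4 and 5,
  finally 6 and 7. Arguments are thus never captured, which is what the side conditions of the
  correctness lemmas express.\<close>

definition joined_fm :: "nat \<Rightarrow> nat \<Rightarrow> nat \<Rightarrow> mso" where
  "joined_fm i x y = Disj (Conj (Eq x y) (Mem x i))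
     (Conj (Neg (Eq x y)) (Ex1 2 (Conj (Mem 2 i) (Conj (Rel x 2) (Rel y 2)))))"

text \<open>The set variable 0 stands for the clique. For a suitable value of the set variable 1, the
  neighbourhoods of clique vertices in that relation form a strictly increasing chain, which
  orders the clique.\<close>
definition clique_less :: "'u struct \<Rightarrow> (nat \<Rightarrow> 'u set) \<Rightarrow> 'u \<Rightarrow> 'u \<Rightarrow> bool" where
  "clique_less \<AA> J a b \<longleftrightarrow> (\<exists>z\<in>fst \<AA>. z \<in> J 0 \<and> joined \<AA> (J 1) b z \<and> \<not> joined \<AA> (J 1) a z)"

definition clique_less_fm :: "nat \<Rightarrow> nat \<Rightarrow> mso" where
  "clique_less_fm x y = Ex1 3 (Conj (Mem 3 0) (Conj (joined_fm 1 y 3) (Neg (joined_fm 1 x 3))))"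

text \<open>Parameter \<open>i\<close> assigns to each vertex the set of clique vertices joined to
  it; these sets are compared lexicographically along the clique order.\<close>

definition colour_less :: "'u struct \<Rightarrow> (nat \<Rightarrow> 'u set) \<Rightarrow> nat \<Rightarrow> 'u \<Rightarrow> 'u \<Rightarrow> bool" where
  "colour_less \<AA> J i a b \<longleftrightarrow>
     set_less (fst \<AA> \<inter> J 0) (clique_less \<AA> J) (joined \<AA> (J i) a) (joined \<AA> (J i) b)"

definition colour_less_fm :: "nat \<Rightarrow> nat \<Rightarrow> nat \<Rightarrow> mso" where
  "colour_less_fm i x y = Ex1 4 (Conj (Mem 4 0) (Conj (joined_fm i y 4) (Conj (Neg (joined_fm i x 4))
     (All1 5 (Imp (Mem 5 0) (Imp (clique_less_fm 4 5) (Iff (joined_fm i x 5) (joined_fm i y 5))))))))"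

definition lexc_fm :: "(nat \<Rightarrow> nat \<Rightarrow> mso) \<Rightarrow> (nat \<Rightarrow> nat \<Rightarrow> mso) \<Rightarrow> nat \<Rightarrow> nat \<Rightarrow> mso" where
  "lexc_fm \<phi> \<psi> x y = Disj (\<phi> x y) (Conj (Neg (\<phi> y x)) (\<psi> x y))"

text \<open>Smaller indices take precedence. With the intended parameters, index 0 separates the
  clique from the independent set, index 1 orders the clique and separates distinct neighbourhoods,
  and the others separate twins.\<close>

fun vertex_less :: "'u struct \<Rightarrow> (nat \<Rightarrow> 'u set) \<Rightarrow> nat \<Rightarrow> 'u \<Rightarrow> 'u \<Rightarrow> bool" where
  "vertex_less \<AA> J 0 = (\<lambda>a b. False)"
| "vertex_less \<AA> J (Suc i) =
     lexc (vertex_less \<AA> J i) (lexc (\<lambda>a b. a \<notin> J i \<and> b \<in> J i) (colour_less \<AA> J i))"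

fun vertex_less_fm :: "nat \<Rightarrow> nat \<Rightarrow> nat \<Rightarrow> mso" where
  "vertex_less_fm 0 = (\<lambda>x y. Neg (Eq x x))"
| "vertex_less_fm (Suc i) =
     lexc_fm (vertex_less_fm i) (lexc_fm (\<lambda>x y. Conj (Neg (Mem x i)) (Mem y i)) (colour_less_fm i))"

text \<open>An edge is compared through its set of endpoints; for a vertex this set is
  empty.\<close>

definition edge_less :: "'u struct \<Rightarrow> (nat \<Rightarrow> 'u set) \<Rightarrow> nat \<Rightarrow> 'u \<Rightarrow> 'u \<Rightarrow> bool" where
  "edge_less \<AA> J k a b \<longleftrightarrow>
     set_less (fst \<AA>) (vertex_less \<AA> J k) (\<lambda>u. snd \<AA> u a) (\<lambda>u. snd \<AA> u b)"

definition edge_less_fm :: "nat \<Rightarrow> nat \<Rightarrow> nat \<Rightarrow> mso" where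
  "edge_less_fm k x y = Ex1 6 (Conj (Rel 6 y) (Conj (Neg (Rel 6 x))
     (All1 7 (Imp (vertex_less_fm k 6 7) (Iff (Rel 7 x) (Rel 7 y))))))"

text \<open>The reflexive order as the negated converse of the strict one, hence the exchanged
  variables 1 and 0.\<close>

definition order_fm :: "nat \<Rightarrow> mso" where
  "order_fm k = Neg (lexc_fm (vertex_less_fm k) (edge_less_fm k) 1 0)"

section \<open>Semantics and free variables of the formulas\<close>

lemma sat_joined_fm:
  "x \<noteq> 2 \<Longrightarrow> y \<noteq> 2 \<Longrightarrow> sat \<AA> I J (joined_fm i x y) \<longleftrightarrow> joined \<AA> (J i) (I x) (I y)"
  by (auto simp: joined_fm_def joined_def)

lemma sat_clique_less_fm:
  "x \<notin> {2, 3} \<Longrightarrow> y \<notin> {2, 3} \<Longrightarrow>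
    sat \<AA> I J (clique_less_fm x y) \<longleftrightarrow> clique_less \<AA> J (I x) (I y)"
  by (simp add: clique_less_fm_def clique_less_def sat_joined_fm)

lemma sat_colour_less_fm:
  "x \<notin> {2, 3, 4, 5} \<Longrightarrow> y \<notin> {2, 3, 4, 5} \<Longrightarrow>
    sat \<AA> I J (colour_less_fm i x y) \<longleftrightarrow> colour_less \<AA> J i (I x) (I y)"
  by (auto simp: colour_less_fm_def colour_less_def set_less_def sat_joined_fm sat_clique_less_fm)

lemma sat_vertex_less_fm:
  "x \<notin> {2, 3, 4, 5} \<Longrightarrow> y \<notin> {2, 3, 4, 5} \<Longrightarrow>
    sat \<AA> I J (vertex_less_fm k x y) \<longleftrightarrow> vertex_less \<AA> J k (I x) (I y)"
  by (induction k arbitrary: x y) (simp_all add: lexc_fm_def lexc_def sat_colour_less_fm)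

lemma sat_edge_less_fm:
  "x < 2 \<Longrightarrow> y < 2 \<Longrightarrow>
    sat \<AA> I J (edge_less_fm k x y) \<longleftrightarrow> edge_less \<AA> J k (I x) (I y)"
  by (simp add: edge_less_fm_def edge_less_def set_less_def sat_vertex_less_fm)

lemma sat_order_fm:
  "sat \<AA> I J (order_fm k) \<longleftrightarrow> \<not> lexc (vertex_less \<AA> J k) (edge_less \<AA> J k) (I 1) (I 0)"
  by (simp add: order_fm_def lexc_fm_def lexc_def sat_vertex_less_fm sat_edge_less_fm)

lemma fv1_vertex_less_fm: "fv1 (vertex_less_fm k x y) \<subseteq> {x, y}"
proof (induction k arbitrary: x y)
  case (Suc k)
  have "fv1 (colour_less_fm k x y) \<subseteq> {x, y}" for x y
    by (auto simp: colour_less_fm_def clique_less_fm_def joined_fm_def)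
  with Suc show ?case by (force simp: lexc_fm_def)
qed simp

lemma fv2_vertex_less_fm: "1 < m \<Longrightarrow> k \<le> m \<Longrightarrow> fv2 (vertex_less_fm k x y) \<subseteq> {..<m}"
  by (induction k arbitrary: x y)
    (auto simp: lexc_fm_def colour_less_fm_def clique_less_fm_def joined_fm_def)

lemma fv_order_fm: "fv1 (order_fm k) \<subseteq> {0, 1}" "1 < k \<Longrightarrow> fv2 (order_fm k) \<subseteq> {..<k}"
  using fv1_vertex_less_fm fv2_vertex_less_fm[of k k]
  by (fastforce simp: order_fm_def lexc_fm_def edge_less_fm_def)+

section \<open>Bounded separation yields an order\<close>

lemma linear_order_from_weak_order:
  assumes "weak_order R" "\<And>a b. a \<in> A \<Longrightarrow> b \<in> A \<Longrightarrow> a \<noteq> b \<Longrightarrow> R a b \<or> R b a"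
  shows "linear_order_on A {(a, b). a \<in> A \<and> b \<in> A \<and> \<not> R b a}"
  using assms unfolding weak_order_def linear_order_on_def partial_order_on_def preorder_on_def
    refl_on_def trans_def antisym_def total_on_def by blast

lemma weak_order_vertex_less:
  assumes "\<And>i. weak_order (colour_less \<AA> J i)"
  shows "weak_order (vertex_less \<AA> J k)"
proof (induction k)
  case (Suc k)
  have "weak_order (\<lambda>a b. a \<notin> J k \<and> b \<in> J k)" by (auto simp: weak_order_def)
  with Suc assms show ?case by (simp add: weak_order_lexc)
qed (simp add: weak_order_def)

text \<open>One separating layer suffices: an earlier layer either decides the pair or passes it on,
  and later layers never revoke a decision.\<close>

lemma vertex_less_total:
  assumes "i < k"
    and "(a \<in> J i) \<noteq> (b \<in> J i) \<or> colour_less \<AA> J i a b \<or> colour_less \<AA> J i b a"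
  shows "vertex_less \<AA> J k a b \<or> vertex_less \<AA> J k b a"
  using assms(1)
proof (induction k)
  case (Suc k)
  show ?case
  proof (cases "i = k")
    case True
    then show ?thesis using assms(2) by (auto simp: lexc_def)
  next
    case False
    then show ?thesis using Suc by (auto simp: lexc_def)
  qed
qed simp

text \<open>The bound is exactly the cardinality of \<open>codes s S\<close>, so each class of twins
  injects into its own set of codes; the injections are then glued along \<open>N\<close>.\<close>

lemma exists_colouring:
  assumes "\<And>S. S \<subseteq> C \<Longrightarrow> card {v\<in>I. N v = S} \<le> 2 ^ (s * (card S + 1))"
    and "finite C" "finite I" "\<And>v. v \<in> I \<Longrightarrow> N v \<subseteq> C"
  obtains g where "\<And>v. v \<in> I \<Longrightarrow> g v \<in> codes s (N v)"
    "\<And>v w. v \<in> I \<Longrightarrow> w \<in> I \<Longrightarrow> N v = N w \<Longrightarrow> g v = g w \<Longrightarrow> v = w"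
proof -
  have ex: "\<exists>f. f ` {v\<in>I. N v = S} \<subseteq> codes s S \<and> inj_on f {v\<in>I. N v = S}" if "S \<subseteq> C" for S
  proof (rule card_le_inj)
    have "finite S" using that assms(2) finite_subset by blast
    then show "finite (codes s S)" "card {v\<in>I. N v = S} \<le> card (codes s S)"
      using assms(1)[OF that] by (simp_all add: finite_codes card_codes)
  qed (use assms in auto)
  have "\<forall>S\<in>Pow C. \<exists>f. f ` {v\<in>I. N v = S} \<subseteq> codes s S \<and> inj_on f {v\<in>I. N v = S}"
    by (intro ballI ex) simp
  from bchoice[OF this] obtain F where F: "\<And>S. S \<subseteq> C \<Longrightarrow>
      F S ` {v\<in>I. N v = S} \<subseteq> codes s S \<and> inj_on (F S) {v\<in>I. N v = S}"
    by (elim exE) blast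
  show thesis
  proof (rule that[of "\<lambda>v. F (N v) v"])
    show "F (N v) v \<in> codes s (N v)" if "v \<in> I" for v
      using F[of "N v"] assms(4)[OF that] that by blast
    show "v = w" if "v \<in> I" "w \<in> I" "N v = N w" "F (N v) v = F (N w) w" for v w
      using F[of "N w"] assms(4)[OF that(2)] that by (auto simp: inj_on_def)
  qed
qed

text \<open>The \<open>s + 2\<close> parameters are the clique, one set for clique order and
  neighbourhoods, and \<open>s\<close> colours that tell twins apart.\<close>

lemma SEP_imp_order:
  assumes fing: "finite_graph G" and split: "split_partition G C I"
    and sep: "\<And>k. Sep G k \<le> 2 ^ (s * (k + 1))"
  shows "\<exists>P. (\<forall>i<s + 2. P i \<subseteq> fst (inc_struct G)) \<and>
    linear_order_on (fst (inc_struct G))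
      {(a, b). a \<in> fst (inc_struct G) \<and> b \<in> fst (inc_struct G) \<and>
         sat (inc_struct G) (\<lambda>i. if i = 0 then a else b) P (order_fm (s + 2))}"
proof -
  let ?S = "inc_struct G"
  let ?A = "fst ?S"
  have disj: "C \<inter> I = {}" and CI: "C \<union> I = verts G"
    and clique: "\<And>u v. u \<in> C \<Longrightarrow> v \<in> C \<Longrightarrow> u \<noteq> v \<Longrightarrow> {u, v} \<in> edges G"
    using split by (auto simp: split_partition_def)
  have finV: "finite (verts G)" using fing by (simp add: finite_graph_def)
  have finC: "finite C" and finI: "finite I" using finV by (simp_all flip: CI)
  have nC: "nbrs G v \<subseteq> C" if "v \<in> I" for v by (rule nbrs_subset_clique[OF fing split that])
  have A: "?A = Inl ` verts G \<union> Inr ` edges G" by (simp add: inc_struct_def)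
  have inc: "snd ?S x y \<longleftrightarrow> (\<exists>v e. x = Inl v \<and> y = Inr e \<and> v \<in> e)" for x y
    by (cases x; cases y) (auto simp: inc_struct_def)

  have card: "card {v\<in>I. nbrs G v = T} \<le> 2 ^ (s * (card T + 1))" if "T \<subseteq> C" for T
  proof -
    have "T \<subseteq> verts G" using that CI by blast
    then have "num_components G T \<le> 2 ^ (s * (card T + 1))"
      using sep[of "card T"] Sep_le_iff[OF fing] by blast
    then show ?thesis
      using card_twins_le_num_components[OF fing split that] by linarith
  qed
  obtain g where g: "\<And>v. v \<in> I \<Longrightarrow> g v \<in> codes s (nbrs G v)"
    "\<And>v w. v \<in> I \<Longrightarrow> w \<in> I \<Longrightarrow> nbrs G v = nbrs G w \<Longrightarrow> g v = g w \<Longrightarrow> v = w"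
    using exists_colouring[where N = "nbrs G", OF card finC finI nC] by blast
  define n where "n = card C"
  obtain f where f: "bij_betw f C {0..<n}"
    using ex_bij_betw_finite_nat[OF finC] n_def by blast
  have fn: "f c < n" if "c \<in> C" for c using f that by (auto simp: bij_betw_def)

  \<comment> \<open>On the clique this is the threshold relation \<open>n \<le> f c + f d\<close>,
    with loops stored as vertices. All edges at independent vertices are added, so that the same set
    reveals their neighbourhoods.\<close>
  define ord where "ord = Inl ` {c\<in>C. n \<le> f c + f c} \<union>
    {Inr {c, d} | c d. c \<in> C \<and> d \<in> C \<and> c \<noteq> d \<and> n \<le> f c + f d} \<union>
    {Inr {v, c} | v c. v \<in> I \<and> c \<in> nbrs G v}"
  define col where "col i = Inl ` {v\<in>I. (i, None) \<in> g v} \<union>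
    {Inr {v, c} | v c. v \<in> I \<and> c \<in> nbrs G v \<and> (i, Some c) \<in> g v}" for i
  define P where "P i = (if i = 0 then Inl ` C else if i = 1 then ord else col (i - 2))" for i :: nat
  have P01: "P 0 = Inl ` C" "P 1 = ord" "P (Suc 0) = ord" and P2: "P (i + 2) = col i" for i
    by (simp_all add: P_def)
  have PA: "P i \<subseteq> ?A" for i
    using CI clique by (auto simp: P_def ord_def col_def A nbrs_def)

  \<comment> \<open>Two distinct vertices lie in at most one common edge, so being joined means that
    this edge belongs to \<open>Z\<close>.\<close>
  have joinedE: "joined ?S Z (Inl u) (Inl v) \<longleftrightarrow> Inr {u, v} \<in> Z"
    if "Z \<subseteq> ?A" "u \<noteq> v" for Z u v
  proof -
    have "e = {u, v}" if "e \<in> edges G" "u \<in> e" "v \<in> e" for e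
      using fing that \<open>u \<noteq> v\<close> unfolding finite_graph_def by fastforce
    moreover have "joined ?S Z (Inl u) (Inl v) \<longleftrightarrow> (\<exists>e\<in>edges G. Inr e \<in> Z \<and> u \<in> e \<and> v \<in> e)"
      using that(2) by (auto simp: joined_def inc A)
    moreover have "Inr {u, v} \<in> Z \<Longrightarrow> {u, v} \<in> edges G" using that(1) A by blast
    ultimately show ?thesis by blast
  qed
  have joined_ord: "joined ?S (P 1) (Inl c) (Inl d) \<longleftrightarrow> n \<le> f c + f d" if "c \<in> C" "d \<in> C" for c d
  proof (cases "c = d")
    case True
    then show ?thesis using that by (auto simp: joined_def P01 ord_def)
  next
    case False
    have "Inr {c, d} \<in> ord \<longleftrightarrow> n \<le> f c + f d"
      using that False disj by (auto simp: ord_def doubleton_eq_iff)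
    then show ?thesis using joinedE[OF PA False, of 1] by (simp add: P01)
  qed
  have joined_nbr: "joined ?S (P 1) (Inl v) (Inl c) \<longleftrightarrow> c \<in> nbrs G v" if "v \<in> I" "c \<in> C" for v c
  proof -
    have "v \<noteq> c" using that disj by blast
    moreover have "Inr {v, c} \<in> ord \<longleftrightarrow> c \<in> nbrs G v"
      using that disj by (auto simp: ord_def doubleton_eq_iff)
    ultimately show ?thesis using joinedE[OF PA, of v c 1] by (simp add: P01)
  qed
  have joined_col: "joined ?S (P (i + 2)) (Inl v) (Inl c) \<longleftrightarrow> c \<in> nbrs G v \<and> (i, Some c) \<in> g v"
    if "v \<in> I" "c \<in> C" for i v c
  proof -
    have "v \<noteq> c" using that disj by blast
    moreover have "Inr {v, c} \<in> col i \<longleftrightarrow> c \<in> nbrs G v \<and> (i, Some c) \<in> g v"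
      using that disj by (auto simp: col_def doubleton_eq_iff)
    ultimately show ?thesis using joinedE[OF PA, of v c "i + 2"] P2 by simp
  qed

  have separator: "\<exists>z\<in>C. n \<le> f d + f z \<and> \<not> n \<le> f c + f z" if "d \<in> C" "f c < f d" for c d
  proof -
    \<comment> \<open>The separating vertex has number \<open>n - f d\<close>: it just reaches the
      threshold with \<open>d\<close> and misses it with \<open>c\<close>. This number is below
      \<open>n\<close> because \<open>f d\<close> is positive.\<close>
    have "n - f d \<in> {0..<n}" using that fn[of d] by auto
    then obtain z where "z \<in> C" "f z = n - f d" using f by (metis bij_betw_def imageE)
    then show ?thesis using that fn[of d] by (intro bexI[of _ z]) auto
  qed
  have cl: "clique_less ?S P (Inl c) (Inl d) \<longleftrightarrow> f c < f d" if "c \<in> C" "d \<in> C" for c d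
  proof -
    have "clique_less ?S P (Inl c) (Inl d) \<longleftrightarrow> (\<exists>z\<in>C. n \<le> f d + f z \<and> \<not> n \<le> f c + f z)"
      using that CI joined_ord by (auto simp: clique_less_def P01(1) A)
    also have "\<dots> \<longleftrightarrow> f c < f d" using separator[OF that(2)] by fastforce
    finally show ?thesis .
  qed
  have AP: "?A \<inter> P 0 = Inl ` C" using CI by (auto simp: A P01)
  interpret C: finite_strict_order "Inl ` C" "clique_less ?S P"
  proof
    show "clique_less ?S P a b \<or> clique_less ?S P b a"
      if "a \<in> Inl ` C" "b \<in> Inl ` C" "a \<noteq> b" for a b
      using that f cl by (auto simp: bij_betw_def inj_on_def) (meson linorder_neqE_nat)
  qed (use finC cl in auto)
  have "weak_order (colour_less ?S P i)" for i
    unfolding colour_less_def AP by (rule weak_order_pullback[OF C.weak_order_set_less])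
  then have wv: "weak_order (vertex_less ?S P k)" for k by (rule weak_order_vertex_less)

  have colour_total: "colour_less ?S P i (Inl u) (Inl v) \<or> colour_less ?S P i (Inl v) (Inl u)"
    if "c \<in> C" "joined ?S (P i) (Inl u) (Inl c) \<noteq> joined ?S (P i) (Inl v) (Inl c)" for i u v c
    unfolding colour_less_def AP using that by (intro C.set_less_total[of "Inl c"]) auto
  let ?L = "vertex_less ?S P (s + 2)"
  have vt: "?L (Inl u) (Inl v) \<or> ?L (Inl v) (Inl u)"
    if uv: "u \<in> verts G" "v \<in> verts G" "u \<noteq> v" for u v
  proof -
    consider "(u \<in> C) \<noteq> (v \<in> C)" | "u \<in> C" "v \<in> C" | "u \<in> I" "v \<in> I" using uv CI by blast
    then show ?thesis
    proof cases
      case 1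
      then show ?thesis by (intro vertex_less_total[of 0]) (auto simp: P01)
    next
      case 2
      then have "f u \<noteq> f v" using f uv by (auto simp: bij_betw_def inj_on_def)
      then obtain z where "z \<in> C" "(n \<le> f u + f z) \<noteq> (n \<le> f v + f z)"
        using separator 2 by (meson linorder_neqE_nat)
      then show ?thesis
        using colour_total[of z 1] joined_ord 2 by (intro vertex_less_total[of 1]) auto
    next
      case 3
      show ?thesis
      proof (cases "nbrs G u = nbrs G v")
        case False
        then obtain c where c: "(c \<in> nbrs G u) \<noteq> (c \<in> nbrs G v)" by blast
        then have "c \<in> C" using nC 3 by blast
        then show ?thesis
          using c colour_total[of c 1] joined_nbr 3 by (intro vertex_less_total[of 1]) auto
      next
        case True
        then have "g u \<noteq> g v" using g(2) 3 uv by blast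
        \<comment> \<open>Twins have different codes, so some bit differs: on the vertices
          themselves if \<open>x\<close> is \<open>None\<close>, on their edges to \<open>c\<close>
          if \<open>x\<close> is \<open>Some c\<close>.\<close>
        then obtain i x where x: "((i, x) \<in> g u) \<noteq> ((i, x) \<in> g v)" by (metis surj_pair set_eqI)
        then have ix: "i < s" "x \<in> insert None (Some ` nbrs G u)"
          using g(1)[OF 3(1)] g(1)[OF 3(2)] True unfolding codes_def by auto
        show ?thesis
        proof (cases x)
          case None
          then have "(Inl u \<in> P (i + 2)) \<noteq> (Inl v \<in> P (i + 2))"
            using x 3 unfolding P2 by (auto simp: col_def)
          then show ?thesis using ix by (intro vertex_less_total[of "i + 2"]) auto
        next
          case (Some c)
          then have c: "c \<in> nbrs G u" "c \<in> C" using ix nC[OF 3(1)] by auto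
          then have "colour_less ?S P (i + 2) (Inl u) (Inl v) \<or> colour_less ?S P (i + 2) (Inl v) (Inl u)"
            using x Some True joined_col 3 by (intro colour_total[of c]) auto
          then show ?thesis using ix by (intro vertex_less_total[of "i + 2"]) auto
        qed
      qed
    qed
  qed
  interpret V: finite_strict_order "Inl ` verts G" ?L
    using finV weak_order_asym[OF wv] weak_order_trans[OF wv] vt
    by unfold_locales blast+
  have edge_less: "edge_less ?S P (s + 2) a b \<longleftrightarrow>
      set_less (Inl ` verts G) ?L (\<lambda>u. snd ?S u a) (\<lambda>u. snd ?S u b)" if "a \<in> ?A" "b \<in> ?A" for a b
  proof -
    have "snd ?S u a \<Longrightarrow> u \<in> Inl ` verts G" "snd ?S u b \<Longrightarrow> u \<in> Inl ` verts G" for u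
      using that fing by (auto simp: inc A finite_graph_def)
    moreover have "Inl ` verts G \<subseteq> ?A" by (auto simp: A)
    ultimately show ?thesis unfolding edge_less_def by (rule set_less_restrict)
  qed
  let ?E = "\<lambda>a b. set_less (Inl ` verts G) ?L (\<lambda>u. snd ?S u a) (\<lambda>u. snd ?S u b)"
  have "weak_order (lexc ?L ?E)"
    using wv weak_order_pullback[OF V.weak_order_set_less] by (rule weak_order_lexc)
  moreover have "lexc ?L ?E a b \<or> lexc ?L ?E b a" if ab: "a \<in> ?A" "b \<in> ?A" "a \<noteq> b" for a b
  proof (cases "a \<in> Inl ` verts G \<and> b \<in> Inl ` verts G")
    case True
    then show ?thesis using V.total ab by (intro lexc_total(2)) blast
  next
    case False
    \<comment> \<open>Distinct edges have distinct endpoint sets, and an edge, unlike a vertex, has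
      a non-empty one.\<close>
    have "\<exists>u\<in>Inl ` verts G. snd ?S u a \<noteq> snd ?S u b"
    proof -
      have "e \<noteq> {} \<and> e \<subseteq> verts G" if "e \<in> edges G" for e
        using that fing unfolding finite_graph_def by fastforce
      then show ?thesis using False ab unfolding A inc by fastforce
    qed
    then show ?thesis using V.set_less_total by (intro lexc_total(1)) metis
  qed
  ultimately have "linear_order_on ?A {(a, b). a \<in> ?A \<and> b \<in> ?A \<and> \<not> lexc ?L ?E b a}"
    by (rule linear_order_from_weak_order)
  moreover have sat_iff: "sat ?S (\<lambda>i. if i = 0 then a else b) P (order_fm (s + 2)) \<longleftrightarrow>
      \<not> lexc ?L ?E b a" if "a \<in> ?A" "b \<in> ?A" for a b
    by (simp only: sat_order_fm lexc_def edge_less[OF that(2,1)] one_neq_zero if_True if_False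
        simp_thms)
  have "{(a, b). a \<in> ?A \<and> b \<in> ?A \<and> sat ?S (\<lambda>i. if i = 0 then a else b) P (order_fm (s + 2))} =
      {(a, b). a \<in> ?A \<and> b \<in> ?A \<and> \<not> lexc ?L ?E b a}"
    by (intro Collect_cong prod.case_cong conj_cong sat_iff refl)
  ultimately have "linear_order_on ?A {(a, b). a \<in> ?A \<and> b \<in> ?A \<and>
      sat ?S (\<lambda>i. if i = 0 then a else b) P (order_fm (s + 2))}"
    by (simp only:)
  with PA show ?thesis by blast
qed

theorem theorem4p31:
  fixes \<C> :: "'a graph set"
  assumes "\<forall>G\<in>\<C>. finite_graph G \<and> split_graph G"
  shows "MSO2_orderable \<C> \<longleftrightarrow> (\<exists>s::nat. has_SEP \<C> (\<lambda>n. 2 ^ (s * (n + 1))))"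
proof
  assume "MSO2_orderable \<C>"
  then show "\<exists>s::nat. has_SEP \<C> (\<lambda>n. 2 ^ (s * (n + 1)))"
    using orderable_imp_SEP[OF assms] unfolding MSO2_orderable_def by blast
next
  assume "\<exists>s::nat. has_SEP \<C> (\<lambda>n. 2 ^ (s * (n + 1)))"
  then obtain s where s: "has_SEP \<C> (\<lambda>n. 2 ^ (s * (n + 1)))" ..
  \<comment> \<open>The formula depends on \<open>s\<close> alone; only the parameters vary with the
    graph.\<close>
  have "defines_order (order_fm (s + 2)) (s + 2) (inc_struct ` \<C>)"
    unfolding defines_order_def
  proof (intro conjI ballI impI)
    fix \<AA> assume "\<AA> \<in> inc_struct ` \<C>"
    then obtain G where G: "G \<in> \<C>" "\<AA> = inc_struct G" by blast
    then obtain C I where "split_partition G C I" using assms split_graph_iff by blast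
    moreover have "Sep G k \<le> 2 ^ (s * (k + 1))" for k
      using s G(1) unfolding has_SEP_def by blast
    ultimately show "\<exists>P. (\<forall>i<s + 2. P i \<subseteq> fst \<AA>) \<and> linear_order_on (fst \<AA>)
        {(a, b). a \<in> fst \<AA> \<and> b \<in> fst \<AA> \<and>
           sat \<AA> (\<lambda>i. if i = 0 then a else b) P (order_fm (s + 2))}"
      using SEP_imp_order assms G by blast
  qed (use fv_order_fm[of "s + 2"] in auto)
  then show "MSO2_orderable \<C>" unfolding MSO2_orderable_def by blast
qed

end
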